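(* Let $r>1$. Then $$\lim_{n\to\infty}\frac{\mathscr{E}_{r,n}}{r^n-1}=1,$$ and $$\lim_{n\to\infty}\frac{\mathscr{D}_{r,n}}{r^n-1}\le\frac1e\quad\text{if } t^{*}\ge\frac{n-1}{n}\ \text{ or }\ t^{**}\le\frac{n-1}{n}.$$
   Context: For $r>1$ and integer $n\ge2$, $$\mathscr{D}_{r,n}:=\max_{i=1,\dots,n-1}\Big\{\Big(1+\frac in(r-1)\Big)^n-r^i\Big\},\qquad \mathscr{E}_{r,n}:=1+\frac{r^n-1}{r-1}\left[\frac{n-1}{n}\Big(\frac{r^n-1}{n(r-1)}\Big)^{\frac1{n-1}}-1\right].$$ Let $\psi(t)=(1+(r-1)t)^n-r^{nt}$ for $t\in[0,1]$ (so $\psi$ depends on $n$ and $r$). Then $t^{*}:=\min\{t\in[0,1]\mid\psi'(t)=0\}$ is the smallest stationary point of $\psi$ on $[0,1]$, and $t^{**}$ is the global maximizer of $\psi$ on $[0,1]$. *)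

theory Defs
  imports "HOL-Analysis.Analysis"
begin

text \<open>
  The quantities are only meaningful for \<open>r > 1\<close> and \<open>n \<ge> 2\<close>; for \<open>n < 2\<close> the maximum below
  ranges over the empty set. They are only ever used as \<open>n\<close> tends to infinity.
\<close>

definition scrD :: "real \<Rightarrow> nat \<Rightarrow> real" where
  "scrD r n = Max ((\<lambda>i. (1 + real i / real n * (r - 1)) ^ n - r ^ i) ` {1..n - 1})"

definition scrE :: "real \<Rightarrow> nat \<Rightarrow> real" where
  "scrE r n = 1 + (r ^ n - 1) / (r - 1) *
     ((real n - 1) / real n * ((r ^ n - 1) / (real n * (r - 1))) powr (1 / (real n - 1)) - 1)"

text \<open>
  The defining formula makes sense, and is differentiable, on the whole real line, so the
  two-sided derivative \<^const>\<open>deriv\<close> coincides at the endpoints of the unit interval with the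
  one-sided derivative of the restriction of the function to that interval.
\<close>

definition psi :: "real \<Rightarrow> nat \<Rightarrow> real \<Rightarrow> real" where
  "psi r n t = (1 + (r - 1) * t) ^ n - r powr (real n * t)"

definition t_star :: "real \<Rightarrow> nat \<Rightarrow> real" where
  "t_star r n = (LEAST t. t \<in> {0..1} \<and> deriv (psi r n) t = 0)"

definition t_star_star :: "real \<Rightarrow> nat \<Rightarrow> real" where
  "t_star_star r n = arg_max_on (psi r n) {0..1}"

end

(* For k = n - i, the i-th term of scrD r n, divided by r^n, is (1 - k c / n)^n - r^(-k) with
   c = 1 - 1/r. It increases with n to g k = exp (- c k) - r^(-k), so the maximum converges to
   the supremum of g over k \<ge> 1. With y = c k one has r^(-k) = (1 - y/k)^k \<ge> 1 - y by
   Bernoulli, so convexity of exp gives g k \<le> exp (- y) - 1 + y \<le> 1/e for y \<le> 1; for y \<ge> 1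
   the bound is immediate. *)
theory Submission
  imports Defs "HOL-Real_Asymp.Real_Asymp"
begin

text \<open>Division by \<open>r ^ n - 1\<close> leaves a vanishing term plus the square bracket
  over \<open>r - 1\<close>, and the bracket itself tends to \<open>r - 1\<close>.\<close>

lemma scrE_ratio_tendsto:
  fixes r :: real
  assumes "r > 1"
  shows "(\<lambda>n. scrE r n / (r ^ n - 1)) \<longlonglongrightarrow> 1"
proof -
  have 1: "(\<lambda>n. 1 / (r ^ n - 1)) \<longlonglongrightarrow> 0"
    using assms by real_asymp
  \<comment> \<open>The root of order \<open>n - 1\<close> of \<open>r ^ n\<close> tends to
    \<open>r\<close>, while that of \<open>n * (r - 1)\<close> tends to 1.\<close>
  have 2: "(\<lambda>n. (real n - 1) / real n * ((r ^ n - 1) / (real n * (r - 1))) powr (1 / (real n - 1)))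
      \<longlonglongrightarrow> r"
    using assms by real_asymp
  have "(\<lambda>n. 1 / (r ^ n - 1) + 1 / (r - 1) *
      ((real n - 1) / real n * ((r ^ n - 1) / (real n * (r - 1))) powr (1 / (real n - 1)) - 1))
      \<longlonglongrightarrow> 0 + 1 / (r - 1) * (r - 1)"
    by (intro tendsto_intros 1 2)
  \<comment> \<open>Cancelling \<open>r ^ n - 1\<close> requires \<open>n > 0\<close>, since it
    vanishes at \<open>n = 0\<close>.\<close>
  moreover have "\<forall>\<^sub>F n in sequentially. 1 / (r ^ n - 1) + 1 / (r - 1) *
      ((real n - 1) / real n * ((r ^ n - 1) / (real n * (r - 1))) powr (1 / (real n - 1)) - 1)
      = scrE r n / (r ^ n - 1)"
    using eventually_gt_at_top[of 0]
  proof eventually_elim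
    case (elim n)
    then have "r ^ n - 1 \<noteq> 0"
      using one_less_power[OF assms, of n] by simp
    then show ?case
      by (simp add: scrE_def add_divide_distrib)
  qed
  ultimately have "(\<lambda>n. scrE r n / (r ^ n - 1)) \<longlonglongrightarrow> 0 + 1 / (r - 1) * (r - 1)"
    by (rule Lim_transform_eventually)
  then show ?thesis
    using assms by simp
qed

lemma exp_minus_power_le:
  fixes x :: real
  assumes "0 \<le> x" "x \<le> 1"
  shows "exp (- (real k * (1 - x))) - x ^ k \<le> 1 / exp 1"
proof (cases "real k * (1 - x) \<ge> 1")
  case True
  then have "exp (- (real k * (1 - x))) \<le> exp (- 1)"
    by simp
  moreover have "x ^ k \<ge> 0"
    using assms by simp
  ultimately show ?thesis
    by (simp add: exp_minus inverse_eq_divide)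
next
  case False
  define y where "y = real k * (1 - x)"
  have y: "0 \<le> y" "y \<le> 1"
    using False assms by (auto simp: y_def)
  have "1 - y \<le> x ^ k"
    using Bernoulli_inequality[of "x - 1" k] assms by (simp add: y_def algebra_simps)
  \<comment> \<open>On [-1, 0] the graph of exp lies below its chord. The term \<open>1 - y\<close>
    of the chord is absorbed by the Bernoulli bound.\<close>
  moreover have "exp (- y) \<le> (1 - y) + y * exp (- 1)"
    using convex_onD[OF exp_convex, of y 0 "-1"] y by simp
  moreover have "y * exp (- 1) \<le> exp (- 1 :: real)"
    using y by (simp add: mult_left_le_one_le)
  ultimately show ?thesis
    by (simp add: y_def exp_minus inverse_eq_divide)
qed

text \<open>Pulling a factor \<open>r\<close> out of the base isolates the growth
  \<open>r ^ n\<close> and leaves, for fixed \<open>k\<close>, an expression of the form (1 -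
  x/n)^n.\<close>

lemma scrD_term_eq:
  fixes r :: real
  assumes "r > 0" "k \<le> n" "n > 0"
  shows "(1 + real (n - k) / real n * (r - 1)) ^ n - r ^ (n - k) =
    r ^ n * ((1 - real k * (1 - 1 / r) / real n) ^ n - (1 / r) ^ k)"
proof -
  have "1 + real (n - k) / real n * (r - 1) = r * (1 - real k * (1 - 1 / r) / real n)"
    using assms by (simp add: of_nat_diff field_simps)
  moreover have "r ^ (n - k) = r ^ n * (1 / r) ^ k"
    using assms by (simp add: power_diff power_one_over)
  ultimately show ?thesis
    by (simp only: power_mult_distrib right_diff_distrib[of "r ^ n"])
qed

text \<open>A single fixed \<open>k\<close> gives each lower bound, and the termwise bound by
  \<open>g k\<close> gives the upper bound for every \<open>n > 1\<close>; pointwise convergence in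
  \<open>k\<close> thus suffices.\<close>

lemma scrD_scaled_tendsto:
  fixes r :: real
  assumes r: "r > 1"
  defines "g \<equiv> \<lambda>k. exp (- (real k * (1 - 1 / r))) - (1 / r) ^ k"
  shows "(\<lambda>n. scrD r n / r ^ n) \<longlonglongrightarrow> (SUP k\<in>{1..}. g k)"
proof (rule order_tendstoI)
  define h where "h = (\<lambda>n k. (1 - real k * (1 - 1 / r) / real n) ^ n - (1 / r) ^ k)"
  have "\<And>k. g k \<le> 1 / exp 1"
    using exp_minus_power_le[of "1 / r"] r by (simp add: g_def)
  then have bdd: "bdd_above (g ` {1..})"
    by (intro bdd_aboveI[of _ "1 / exp 1"]) auto
  fix a :: real
  {
    assume "a < (SUP k\<in>{1..}. g k)"
    then obtain k where k: "k \<ge> 1" "a < g k"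
      using less_cSUP_iff[OF _ bdd] by auto
    have "(\<lambda>n. (1 + - (real k * (1 - 1 / r)) / real n) ^ n) \<longlonglongrightarrow> exp (- (real k * (1 - 1 / r)))"
      by (rule tendsto_exp_limit_sequentially)
    then have "(\<lambda>n. h n k) \<longlonglongrightarrow> g k"
      unfolding h_def g_def by (intro tendsto_diff tendsto_const) simp
    then have "\<forall>\<^sub>F n in sequentially. a < h n k"
      using k by (rule_tac order_tendstoD)
    \<comment> \<open>With \<open>k \<ge> 1\<close>, the condition \<open>n > k\<close> places the
      index \<open>n - k\<close> in \<open>{1..n - 1}\<close>.\<close>
    then show "\<forall>\<^sub>F n in sequentially. a < scrD r n / r ^ n"
      using eventually_gt_at_top[of k]
    proof eventually_elim
      case (elim n)
      have "r ^ n * h n k = (1 + real (n - k) / real n * (r - 1)) ^ n - r ^ (n - k)"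
        using scrD_term_eq[of r k n] elim r by (simp add: h_def)
      also have "\<dots> \<le> scrD r n"
        unfolding scrD_def using elim k by (intro Max_ge imageI) auto
      finally have "h n k \<le> scrD r n / r ^ n"
        using r by (simp add: field_simps)
      with elim show ?case by simp
    qed
  next
    assume a: "(SUP k\<in>{1..}. g k) < a"
    show "\<forall>\<^sub>F n in sequentially. scrD r n / r ^ n < a"
      \<comment> \<open>For \<open>n > 1\<close> the index set is nonempty, so the maximum is
        attained.\<close>
      using eventually_gt_at_top[of 1]
    proof eventually_elim
      case (elim n)
      have "scrD r n \<in> (\<lambda>i. (1 + real i / real n * (r - 1)) ^ n - r ^ i) ` {1..n - 1}"
        unfolding scrD_def using elim by (intro Max_in) auto
      then obtain i where i: "i \<in> {1..n - 1}"
        "scrD r n = (1 + real i / real n * (r - 1)) ^ n - r ^ i"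
        by auto
      define k where "k = n - i"
      have k: "1 \<le> k" "k \<le> n" "i = n - k"
        using i elim by (auto simp: k_def)
      have "scrD r n = r ^ n * h n k"
        using scrD_term_eq[of r k n] k i elim r by (simp add: h_def)
      then have "scrD r n / r ^ n = h n k"
        using r by simp
      \<comment> \<open>This keeps the base 1 - x/n nonnegative, as the inequality (1 - x/n)^n \<le>
        exp(-x) requires.\<close>
      also have "real k * (1 - 1 / r) \<le> real n * 1"
        using k r by (intro mult_mono) auto
      then have "h n k \<le> g k"
        unfolding h_def g_def
        using exp_ge_one_minus_x_over_n_power_n[of "real k * (1 - 1 / r)" n] elim by simp
      also have "g k \<le> (SUP k\<in>{1..}. g k)"
        using k bdd by (intro cSUP_upper) auto
      finally show ?case using a by simp
    qed
  }
qed

lemma scrD_ratio_tendsto: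
  fixes r :: real
  assumes r: "r > 1"
  defines "g \<equiv> \<lambda>k. exp (- (real k * (1 - 1 / r))) - (1 / r) ^ k"
  shows "(\<lambda>n. scrD r n / (r ^ n - 1)) \<longlonglongrightarrow> (SUP k\<in>{1..}. g k)"
proof -
  \<comment> \<open>This factor replaces the denominator \<open>r ^ n\<close> by
    \<open>r ^ n - 1\<close>.\<close>
  have "(\<lambda>n. r ^ n / (r ^ n - 1)) \<longlonglongrightarrow> 1"
    using r by real_asymp
  from tendsto_mult[OF scrD_scaled_tendsto[OF r] this] show ?thesis
    using r by (simp add: g_def)
qed

theorem proposition4p3:
  fixes r :: real
  assumes "r > 1"
  shows "((\<lambda>n. scrE r n / (r ^ n - 1)) \<longlonglongrightarrow> 1) \<and>
    ((\<forall>\<^sub>F n in sequentially.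
        t_star r n \<ge> (real n - 1) / real n \<or> t_star_star r n \<le> (real n - 1) / real n)
     \<longrightarrow> convergent (\<lambda>n. scrD r n / (r ^ n - 1))
         \<and> lim (\<lambda>n. scrD r n / (r ^ n - 1)) \<le> 1 / exp 1)"
proof -
  let ?L = "SUP k\<in>{1..}. exp (- (real k * (1 - 1 / r))) - (1 / r) ^ k"
  have "?L \<le> 1 / exp 1"
    using exp_minus_power_le[of "1 / r"] assms by (intro cSUP_least) auto
  then show ?thesis
    using scrE_ratio_tendsto[OF assms] scrD_ratio_tendsto[OF assms]
    by (auto simp: limI convergent_def)
qed

end
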